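(* Let $G$ be any infinite abelian group and let $h\geq 2$ be an integer. Then $G$ has a nice minimal basis of order $h$; that is, there is a set $A\subset G$ with $\operatorname{ord}^*_G(A)=h$ and $hA=G$, such that for every $a\in A$, the set $A\setminus\{a\}$ is not a basis of order at most $h$ (i.e. $h(A\setminus\{a\})\not\sim G$).
   Context: For $A\subset G$ and a positive integer $h$, $hA$ denotes the set of sums of $h$ not necessarily distinct elements of $A$. For $A,B\subset G$, write $A\sim B$ if the symmetric difference of $A$ and $B$ is finite. $A$ is a basis of order at most $h$ if $hA\sim G$; $\operatorname{ord}^*_G(A)$ is the least such $h$ (or $\infty$ if none exists). A basis of order $h$ is nice if $hA=G$, and minimal if for every $a\in A$ the set $A\setminus\{a\}$ is not a basis of order at most $h$. *)

theory Defs
  imports Main "HOL-Library.Extended_Nat"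
begin

definition hfold :: "nat \<Rightarrow> 'a::comm_monoid_add set \<Rightarrow> 'a set" where
  "hfold h A = {sum_list xs | xs. length xs = h \<and> set xs \<subseteq> A}"

definition almost_eq :: "'a set \<Rightarrow> 'a set \<Rightarrow> bool" (infix "\<sim>" 50) where
  "A \<sim> B \<longleftrightarrow> finite (sym_diff A B)"

definition basis_at_most :: "nat \<Rightarrow> 'a::ab_group_add set \<Rightarrow> bool" where
  "basis_at_most h A \<longleftrightarrow> hfold h A \<sim> UNIV"

text \<open>Orders are positive integers. The infimum of the empty set in \<^typ>\<open>enat\<close> is
  \<^term>\<open>\<infinity> :: enat\<close>, which covers sets that are not a basis of any order.\<close>

definition ord_star :: "'a::ab_group_add set \<Rightarrow> enat" where
  "ord_star A = (INF h\<in>{h. h \<ge> 1 \<and> basis_at_most h A}. enat h)"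

definition nice_basis :: "nat \<Rightarrow> 'a::ab_group_add set \<Rightarrow> bool" where
  "nice_basis h A \<longleftrightarrow> ord_star A = enat h \<and> hfold h A = UNIV"

definition minimal_basis :: "nat \<Rightarrow> 'a::ab_group_add set \<Rightarrow> bool" where
  "minimal_basis h A \<longleftrightarrow> ord_star A = enat h \<and> (\<forall>a\<in>A. \<not> basis_at_most h (A - {a}))"

end

theory Submission
  imports Defs "HOL-Computational_Algebra.Primes"
begin

text \<open>
  Let $\kappa = |G|$. The integers $c$ with $|cG| < \kappa$ form an ideal $d\mathbb{Z}$ with
  $d \neq 1$; put $D = dG$. The set $A$ is built by a transfinite recursion of length $\kappa$,
  adding finitely many elements at each stage. To represent $g$, one adds $b_1, \dots, b_h$ with
  sum $g$ where $b_1, \dots, b_{h-1}$ are generic: no integer combination with bounded coefficients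
  that are not all divisible by $d$ lies in a prescribed set of size less than $\kappa$.
  To make $a \in A$ indispensable, one adds generic $b_1, \dots, b_{h-1}$ and declares
  $p = a + b_1 + \dots + b_{h-1}$ protected: from then on $p$ must stay outside
  $h(A \setminus \{a\})$ and outside $jA + D$ for $j < h$. Sums involving new generic elements can
  only hit a protected $p$ when all their multiplicities are divisible by $d$, and then those
  elements contribute an element of $D$ while using up summands, which the second condition excludes.
  Every $a \in A$ is treated $\kappa$ times, so it gets infinitely many protected elements.
\<close>

unbundle cardinal_syntax

section \<open>Integer multiples in an abelian group\<close>

definition nat_scale :: "nat \<Rightarrow> 'a::ab_group_add \<Rightarrow> 'a" where
  "nat_scale n x = (\<Sum>i<n. x)"

definition int_scale :: "int \<Rightarrow> 'a::ab_group_add \<Rightarrow> 'a" where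
  "int_scale c x = nat_scale (nat c) x - nat_scale (nat (- c)) x"

lemma nat_scale_simps [simp]:
  "nat_scale 0 x = 0" "nat_scale (Suc n) x = nat_scale n x + x"
  by (simp_all add: nat_scale_def)

lemma nat_scale_add: "nat_scale (m + n) x = nat_scale m x + nat_scale n x"
  by (induction m) (simp_all add: algebra_simps)

lemma nat_scale_diff_right: "nat_scale n (x - y) = nat_scale n x - nat_scale n y"
  by (induction n) (simp_all add: algebra_simps)

lemma nat_scale_add_right: "nat_scale n (x + y) = nat_scale n x + nat_scale n y"
  by (induction n) (simp_all add: algebra_simps)

lemma nat_scale_mult: "nat_scale (m * n) x = nat_scale m (nat_scale n x)"
  by (induction m) (simp_all add: nat_scale_add algebra_simps)

text \<open>Every integer is a difference of naturals, so this formula turns each module law into an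
  identity between \<open>nat_scale\<close> terms.\<close>

lemma int_scale_diff: "int_scale (int m - int n) x = nat_scale m x - nat_scale n x"
proof (cases "n \<le> m")
  case True
  then obtain k where "m = n + k"
    using le_Suc_ex by blast
  then show ?thesis
    by (simp add: int_scale_def nat_scale_add)
next
  case False
  then obtain k where "n = m + k"
    using le_Suc_ex by (metis nat_le_linear)
  then show ?thesis
    by (simp add: int_scale_def nat_scale_add)
qed

interpretation int_scale: module int_scale
proof
  fix a b :: int and x y :: 'a
  obtain m n where a: "a = int m - int n"
    by (rule int_diff_cases)
  obtain k l where b: "b = int k - int l"
    by (rule int_diff_cases)
  show "int_scale a (x + y) = int_scale a x + int_scale a y"
    unfolding a int_scale_diff by (simp add: nat_scale_add_right)
  have "a + b = int (m + k) - int (n + l)"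
    by (simp add: a b)
  then show "int_scale (a + b) x = int_scale a x + int_scale b x"
    by (simp only: int_scale_diff a b) (simp add: nat_scale_add)
  have "a * b = int (m * k + n * l) - int (m * l + n * k)"
    by (simp add: a b algebra_simps)
  then show "int_scale a (int_scale b x) = int_scale (a * b) x"
    by (simp only: int_scale_diff a b)
      (simp add: nat_scale_add nat_scale_diff_right nat_scale_mult)
  show "int_scale 1 x = x"
    by (simp add: int_scale_def)
qed

section \<open>Sets of smaller cardinality than the group\<close>

definition small :: "'a set \<Rightarrow> bool" where
  "small S \<longleftrightarrow> |S| <o |UNIV :: 'a set|"

lemma small_subset: "small T \<Longrightarrow> S \<subseteq> T \<Longrightarrow> small S"
  unfolding small_def using card_of_mono1 ordLeq_ordLess_trans by blast

lemma small_image: "small S \<Longrightarrow> small (f ` S)" for f :: "'a \<Rightarrow> 'a"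
  unfolding small_def using card_of_image ordLeq_ordLess_trans by blast

lemma not_small_UNIV: "\<not> small UNIV"
  unfolding small_def using ordLess_irreflexive by blast

lemma card_of_finite_ordLess_infinite: "finite A \<Longrightarrow> infinite B \<Longrightarrow> |A| <o |B|"
  by (rule finite_ordLess_infinite) (simp_all add: Field_card_of card_of_well_order_on)

locale infinite_type =
  fixes ty :: "'a itself"
  assumes infinite_UNIV: "infinite (UNIV :: 'a set)"
begin

lemma small_finite: "finite (S :: 'a set) \<Longrightarrow> small S"
  unfolding small_def
  using infinite_UNIV by (simp add: card_of_finite_ordLess_infinite)

lemma small_Un: "small S \<Longrightarrow> small T \<Longrightarrow> small (S \<union> T)" for S T :: "'a set"
  unfolding small_def using infinite_UNIV card_of_Un_ordLess_infinite by blast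

lemma small_Union_finite:
  fixes S :: "'i \<Rightarrow> 'a set"
  shows "finite I \<Longrightarrow> (\<And>i. i \<in> I \<Longrightarrow> small (S i)) \<Longrightarrow> small (\<Union>i\<in>I. S i)"
  by (induction I rule: finite_induct) (auto intro: small_Un small_finite)

text \<open>Finiteness of the pieces replaces regularity of the cardinal \<kappa> of the group: for
  singular \<kappa>, fewer than \<kappa> sets of size below \<kappa> can have a union of size
  \<kappa>. Hence each stage of the construction adds only finitely many elements.\<close>

lemma small_Union_of_finite:
  fixes B :: "'a \<Rightarrow> 'a set"
  assumes "small I" "\<And>i. i \<in> I \<Longrightarrow> finite (B i)"
  shows "small (\<Union>i\<in>I. B i)"
proof (cases "finite I")
  case True
  then show ?thesis
    using assms by (intro small_finite) auto
next
  case False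
  have "|\<Union>i\<in>I. B i| \<le>o |I|"
  proof (rule card_of_UNION_ordLeq_infinite[OF False])
    show "|I| \<le>o |I|"
      using card_of_Card_order by (intro card_of_mono1) simp
    show "\<forall>i\<in>I. |B i| \<le>o |I|"
      using assms(2) False by (simp add: ordLess_imp_ordLeq card_of_finite_ordLess_infinite)
  qed
  then show ?thesis
    using assms(1) unfolding small_def by (rule ordLeq_ordLess_trans)
qed

lemma card_of_Times_small:
  fixes S T :: "'a set"
  assumes S: "small S" and T: "small T"
  shows "|S \<times> T| <o |UNIV :: 'a set|"
proof (cases "finite S \<and> finite T")
  case True
  then show ?thesis
    using infinite_UNIV by (simp add: card_of_finite_ordLess_infinite)
next
  case False
  have refl: "|X| \<le>o |X|" for X :: "'a set"
    by (rule card_of_mono1) simp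
  have "|S| \<le>o |T| \<or> |T| \<le>o |S|"
    by (metis card_of_Well_order ordLeq_total)
  then show ?thesis
  proof
    assume le: "|S| \<le>o |T|"
    then have "infinite T"
      using False card_of_ordLeq_finite by blast
    then have "|S \<times> T| \<le>o |T|"
      using le refl by (intro card_of_Sigma_ordLeq_infinite) auto
    then show ?thesis
      using T unfolding small_def by (rule ordLeq_ordLess_trans)
  next
    assume le: "|T| \<le>o |S|"
    then have "infinite S"
      using False card_of_ordLeq_finite by blast
    then have "|S \<times> T| \<le>o |S|"
      using le refl by (intro card_of_Sigma_ordLeq_infinite) auto
    then show ?thesis
      using S unfolding small_def by (rule ordLeq_ordLess_trans)
  qed
qed

lemma small_image2:
  fixes f :: "'a \<Rightarrow> 'a \<Rightarrow> 'a"
  assumes "small S" "small T"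
  shows "small {f x y | x y. x \<in> S \<and> y \<in> T}"
proof -
  have "{f x y | x y. x \<in> S \<and> y \<in> T} = case_prod f ` (S \<times> T)"
    by auto
  moreover have "|case_prod f ` (S \<times> T)| <o |UNIV :: 'a set|"
    using card_of_image card_of_Times_small[OF assms] by (rule ordLeq_ordLess_trans)
  ultimately show ?thesis
    by (simp add: small_def)
qed

text \<open>The first projection of G x G is transported along a bijection with G. The map serves as
  a schedule: stage x deals with \<open>t x\<close>, so every element has its turn at as many stages
  as G has elements.\<close>

lemma ex_map_with_large_fibers: "\<exists>t :: 'a \<Rightarrow> 'a. \<forall>a. \<not> small {x. t x = a}"
proof -
  have "|UNIV \<times> UNIV :: ('a \<times> 'a) set| =o |UNIV :: 'a set|"
    using infinite_UNIV by (rule card_of_Times_same_infinite)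
  then obtain e :: "'a \<times> 'a \<Rightarrow> 'a" where e: "bij e"
    using card_of_ordIso by (metis UNIV_Times_UNIV)
  define t where "t x = fst (inv e x)" for x
  have "\<not> small {x. t x = a}" for a
  proof
    assume "small {x. t x = a}"
    then have "small ((\<lambda>x. snd (inv e x)) ` {x. t x = a})"
      by (rule small_image)
    moreover have "(\<lambda>x. snd (inv e x)) ` {x. t x = a} = UNIV"
    proof -
      have "y \<in> (\<lambda>x. snd (inv e x)) ` {x. t x = a}" for y
        by (rule image_eqI[of _ _ "e (a, y)"]) (use e in \<open>auto simp: t_def bij_is_inj\<close>)
      then show ?thesis by blast
    qed
    ultimately show False
      using not_small_UNIV by metis
  qed
  then show ?thesis by blast
qed

end

section \<open>Generic elements\<close>

text \<open>The value \<open>d = 0\<close> is allowed: then 0 is the only integer with a small set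
  of multiples, and dG is trivial.\<close>

locale torsion_modulus = infinite_type ty for ty :: "'a::ab_group_add itself" +
  fixes d :: nat
  assumes modulus_ne_1: "d \<noteq> 1"
    and small_multiples: "small (range (int_scale (int d) :: 'a \<Rightarrow> 'a))"
    and large_multiples: "\<not> int d dvd c \<Longrightarrow> \<not> small (range (int_scale c :: 'a \<Rightarrow> 'a))"


text \<open>Since (a - k b) x = a x - b (k x), the set \<open>J\<close> is closed under a - k b and
  is an ideal of the integers. It is proper because the multiples by 1 fill the group. Division with
  remainder finds its generator.\<close>

lemma ex_torsion_modulus:
  assumes "infinite (UNIV :: 'a::ab_group_add set)"
  shows "\<exists>d. torsion_modulus TYPE('a) d"
proof -
  interpret infinite_type "TYPE('a)"
    by standard (rule assms)
  define J where "J = {c. small (range (int_scale c :: 'a \<Rightarrow> 'a))}"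
  have diff: "a - k * b \<in> J" if "a \<in> J" "b \<in> J" for a b k
  proof -
    have "range (int_scale (a - k * b) :: 'a \<Rightarrow> 'a)
        \<subseteq> {x - y | x y. x \<in> range (int_scale a) \<and> y \<in> range (int_scale b)}"
    proof
      fix z :: 'a
      assume "z \<in> range (int_scale (a - k * b))"
      then obtain x where "z = int_scale (a - k * b) x"
        by blast
      then have "z = int_scale a x - int_scale b (int_scale k x)"
        by (simp add: int_scale.scale_left_diff_distrib mult.commute)
      then show "z \<in> {x - y | x y. x \<in> range (int_scale a) \<and> y \<in> range (int_scale b)}"
        by blast
    qed
    then show ?thesis
      using that small_image2 small_subset unfolding J_def by blast
  qed
  have zero: "0 \<in> J"
    unfolding J_def by (auto intro!: small_finite simp: image_constant_conv)
  have one: "1 \<notin> J"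
    using not_small_UNIV by (simp add: J_def)
  show ?thesis
  proof (cases "J = {0}")
    case True
    have "torsion_modulus TYPE('a) 0"
      by unfold_locales (use True in \<open>auto simp: J_def set_eq_iff small_finite\<close>)
    then show ?thesis by blast
  next
    case False
    then obtain c where c: "c \<in> J" "c \<noteq> 0"
      using zero by blast
    then have "- c \<in> J"
      using diff[OF zero c(1), of 1] by simp
    with c have ex: "\<exists>n::nat. n > 0 \<and> int n \<in> J"
      by (intro exI[of _ "nat \<bar>c\<bar>"]) (auto simp: abs_if)
    define d where "d = (LEAST n::nat. n > 0 \<and> int n \<in> J)"
    have d: "d > 0" "int d \<in> J"
      using LeastI_ex[OF ex] by (auto simp: d_def)
    have "int d dvd a" if "a \<in> J" for a
    proof (rule ccontr)
      assume "\<not> int d dvd a"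
      then have "a mod int d \<noteq> 0"
        by auto
      moreover have "a mod int d \<ge> 0" "a mod int d < int d"
        using d(1) by simp_all
      ultimately have "a mod int d > 0" "a mod int d < int d"
        by linarith+
      moreover have "a mod int d \<in> J"
        using diff[OF that d(2), of "a div int d"] by (simp add: minus_div_mult_eq_mod)
      ultimately have "nat (a mod int d) < d" "nat (a mod int d) > 0 \<and> int (nat (a mod int d)) \<in> J"
        by auto
      then show False
        unfolding d_def using not_less_Least by blast
    qed
    then have "torsion_modulus TYPE('a) d"
      using d one by unfold_locales (auto simp: J_def)
    then show ?thesis by blast
  qed
qed

section \<open>The subgroup dG and elements that are generic modulo it\<close>

context torsion_modulus
begin

definition D :: "'a set" where
  "D = range (int_scale (int d))"

lemma small_D: "small D"
  unfolding D_def by (rule small_multiples)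

lemma zero_in_D: "0 \<in> D"
  unfolding D_def by (rule image_eqI[of _ _ 0]) auto

lemma add_in_D: "x \<in> D \<Longrightarrow> y \<in> D \<Longrightarrow> x + y \<in> D"
  unfolding D_def by (auto simp flip: int_scale.scale_right_distrib)

lemma uminus_in_D: "x \<in> D \<Longrightarrow> - x \<in> D"
  unfolding D_def by (auto simp flip: int_scale.scale_minus_right)

lemma sum_in_D: "(\<And>i. i \<in> I \<Longrightarrow> f i \<in> D) \<Longrightarrow> sum f I \<in> D"
  by (induction I rule: infinite_finite_induct) (auto simp: zero_in_D add_in_D)

lemma int_scale_in_D: "int d dvd c \<Longrightarrow> int_scale c x \<in> D"
  unfolding D_def by (auto elim!: dvdE simp flip: int_scale.scale_scale)

lemma not_modulus_dvd_1: "\<not> int d dvd 1"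
  using modulus_ne_1 by simp

text \<open>\<open>L\<close> is a common multiple of all nonzero c of absolute value at most N. If c
  b lies in \<open>S\<close>, then L b lies in (L/c) S, one of finitely many small sets, whereas the
  set of all L b is not small.\<close>

lemma ex_generic_torsion_free:
  fixes S :: "'a set" and N :: int
  assumes "d = 0" "small S"
  shows "\<exists>b. \<forall>c. \<bar>c\<bar> \<le> N \<longrightarrow> \<not> int d dvd c \<longrightarrow> int_scale c b \<notin> S"
proof -
  define L :: int where "L = \<Prod>{1..N}"
  define S' where "S' = (\<Union>c\<in>{-N..N}. int_scale (L div c) ` S)"
  have "small S'"
    unfolding S'_def using assms(2) by (intro small_Union_finite small_image) auto
  moreover have "L \<noteq> 0"
    by (simp add: L_def)
  then have "\<not> small (range (int_scale L :: 'a \<Rightarrow> 'a))"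
    using assms(1) by (intro large_multiples) simp
  ultimately obtain b where b: "int_scale L b \<notin> S'"
    using small_subset by blast
  have "int_scale c b \<notin> S" if c: "\<bar>c\<bar> \<le> N" "c \<noteq> 0" for c
  proof
    assume S: "int_scale c b \<in> S"
    have "\<bar>c\<bar> dvd L"
      unfolding L_def using c by (intro dvd_prodI) auto
    then have "int_scale L b = int_scale (L div c) (int_scale c b)"
      by simp
    then have "int_scale L b \<in> int_scale (L div c) ` S"
      using S by (rule image_eqI)
    moreover have "c \<in> {-N..N}"
      using c(1) by (simp add: abs_le_iff)
    ultimately show False
      using b unfolding S'_def by blast
  qed
  then show ?thesis
    using assms(1) by auto
qed

text \<open>If d does not divide c, then d / gcd(c, d) has a prime factor q, and d/q is an integer
  combination of c and d. So it suffices that, for each prime q dividing d, the element (d/q) b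
  avoids finitely many multiples of \<open>S\<close> modulo \<open>D\<close>.\<close>

lemma ex_generic_torsion:
  fixes S :: "'a set"
  assumes "d > 0" "small S"
  shows "\<exists>b. \<forall>c. \<not> int d dvd c \<longrightarrow> int_scale c b \<notin> S"
proof -
  define S' where "S' = {x + y | x y. x \<in> (\<Union>e\<in>{0..int d}. int_scale e ` S) \<and> y \<in> D}"
  have small: "small S'"
    unfolding S'_def using assms(2)
    by (intro small_image2 small_Union_finite small_image small_D) auto
  have S'_D: "z + y \<in> S'" if z: "z \<in> S'" and y: "y \<in> D" for z y
  proof -
    from z obtain x y' where "z = x + y'" "x \<in> (\<Union>e\<in>{0..int d}. int_scale e ` S)" "y' \<in> D"
      unfolding S'_def by blast
    then have "z + y = x + (y' + y)" "y' + y \<in> D"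
      using y by (simp_all add: add_in_D add.assoc)
    with \<open>x \<in> _\<close> show ?thesis
      unfolding S'_def by blast
  qed
  \<comment> \<open>Multiplying by \<open>w q\<close> makes the contribution of \<open>x r\<close>, for the other primes \<open>r\<close>, vanish
    modulo \<open>D\<close> after scaling by \<open>d div q\<close>.\<close>
  define Q where "Q = {q. prime q \<and> q dvd d}"
  have "Q \<subseteq> {..d}"
    unfolding Q_def using assms(1) by (auto dest: dvd_imp_le)
  then have fin: "finite Q"
    using finite_subset by blast
  define w where "w q = \<Prod>(Q - {q})" for q
  define m where "m q = int (d div q)" for q
  \<comment> \<open>The prime factors of \<open>w q\<close> differ from q, so d does not divide
    (d/q) \<open>w q\<close>, and multiplication by that number has a large range.\<close>
  have "\<exists>x. int_scale (m q * int (w q)) x \<notin> S'" if q: "q \<in> Q" for q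
  proof -
    have "\<not> q dvd w q"
    proof
      assume "q dvd w q"
      then obtain q' where "q' \<in> Q - {q}" "q dvd q'"
        using q fin unfolding w_def Q_def by (auto simp: prime_dvd_prod_iff)
      then show False
        using q primes_dvd_imp_eq unfolding Q_def by blast
    qed
    moreover have "d = d div q * q" "d div q > 0"
      using q assms(1) unfolding Q_def by (auto simp: div_greater_zero_iff dvd_imp_le prime_gt_0_nat)
    ultimately have "\<not> d dvd d div q * w q"
      by (metis nat_mult_dvd_cancel1)
    then have "\<not> small (range (int_scale (m q * int (w q)) :: 'a \<Rightarrow> 'a))"
      unfolding m_def by (intro large_multiples) (simp flip: of_nat_mult)
    then show ?thesis
      using small small_subset by blast
  qed
  then obtain x where x: "\<And>q. q \<in> Q \<Longrightarrow> int_scale (m q * int (w q)) (x q) \<notin> S'"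
    by metis
  define b where "b = (\<Sum>q\<in>Q. int_scale (int (w q)) (x q))"
  have b: "int_scale (m q) b \<notin> S'" if q: "q \<in> Q" for q
  proof
    assume "int_scale (m q) b \<in> S'"
    have "int_scale (m q) b = (\<Sum>r\<in>Q. int_scale (m q * int (w r)) (x r))"
      unfolding b_def by (simp add: int_scale.scale_sum_right)
    also have "\<dots> = int_scale (m q * int (w q)) (x q) +
        (\<Sum>r\<in>Q - {q}. int_scale (m q * int (w r)) (x r))"
      using fin q by (rule sum.remove)
    finally have eq: "int_scale (m q * int (w q)) (x q) =
        int_scale (m q) b + - (\<Sum>r\<in>Q - {q}. int_scale (m q * int (w r)) (x r))"
      by simp
    have "(\<Sum>r\<in>Q - {q}. int_scale (m q * int (w r)) (x r)) \<in> D"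
    proof (intro sum_in_D int_scale_in_D)
      fix r assume "r \<in> Q - {q}"
      then have "q dvd w r"
        using q fin unfolding w_def by (intro dvd_prodI) auto
      moreover have "d = d div q * q"
        using q unfolding Q_def by simp
      ultimately have "d dvd d div q * w r"
        by (metis dvd_refl mult_dvd_mono)
      then show "int d dvd m q * int (w r)"
        unfolding m_def by (simp flip: of_nat_mult)
    qed
    then show False
      using x[OF q] eq S'_D[OF \<open>int_scale (m q) b \<in> S'\<close>] uminus_in_D by metis
  qed
  have "int_scale c b \<notin> S" if c: "\<not> int d dvd c" for c
  proof
    assume S: "int_scale c b \<in> S"
    define g where "g = gcd c (int d)"
    have "g > 0"
      using assms(1) by (simp add: g_def)
    have "g dvd int d"
      by (simp add: g_def)
    then obtain k where k: "int d = g * k"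
      by blast
    have "k \<noteq> 1"
      using c k by (metis g_def gcd_dvd1 mult.right_neutral)
    moreover have "k > 0"
      using k assms(1) \<open>g > 0\<close> by (metis of_nat_0_less_iff zero_less_mult_pos)
    ultimately have "nat k \<noteq> 1"
      by linarith
    then obtain q where q: "prime q" "q dvd nat k"
      using prime_factor_nat by blast
    then obtain l where "nat k = q * l"
      by blast
    then have kl: "k = int q * int l"
      using \<open>k > 0\<close> by (metis int_nat_eq less_le of_nat_mult)
    have "int d = int q * (g * int l)"
      using k kl by (simp add: algebra_simps)
    then have "int q dvd int d"
      by simp
    then have qQ: "q \<in> Q"
      using q by (simp add: Q_def)
    have m: "m q = g * int l"
      unfolding m_def zdiv_int using \<open>int d = int q * (g * int l)\<close> q by (auto simp: prime_gt_0_nat)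
    obtain u v where "u * c + v * int d = g"
      unfolding g_def using bezout_int by blast
    then have "m q = (int l * u) * c + (int l * v) * int d"
      unfolding m by (auto simp: algebra_simps)
    \<comment> \<open>The coefficient of c is reduced modulo d to become one of the finitely many
      used in \<open>S'\<close>; the discarded part is a multiple of d and falls into
      \<open>D\<close>.\<close>
    also have "\<dots> = ((int l * u) mod int d) * c + int d * (int l * v + (int l * u) div int d * c)"
    proof -
      have "int l * u = (int l * u) div int d * int d + (int l * u) mod int d"
        by simp
      then have "int l * u * c = ((int l * u) div int d * int d + (int l * u) mod int d) * c"
        by (rule arg_cong)
      then show ?thesis
        by (simp only: algebra_simps)
    qed
    finally have "int_scale (m q) b = int_scale ((int l * u) mod int d) (int_scale c b) +
        int_scale (int d * (int l * v + (int l * u) div int d * c)) b"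
      by (simp only: int_scale.scale_left_distrib int_scale.scale_scale)
    moreover have "int_scale (int d * (int l * v + (int l * u) div int d * c)) b \<in> D"
      by (rule int_scale_in_D) simp
    moreover have "(int l * u) mod int d \<in> {0..int d}"
      using assms(1) by (simp add: order_less_imp_le)
    ultimately have "int_scale (m q) b \<in> S'"
      using S unfolding S'_def by blast
    then show False
      using b[OF qQ] by blast
  qed
  then show ?thesis by blast
qed

lemma ex_generic_element:
  fixes S :: "'a set" and N :: int
  assumes "small S"
  shows "\<exists>b. \<forall>c. \<bar>c\<bar> \<le> N \<longrightarrow> \<not> int d dvd c \<longrightarrow> int_scale c b \<notin> S"
  using ex_generic_torsion_free ex_generic_torsion assms by (cases "d = 0") blast+

lemma finite_bounded_combinations:
  fixes b :: "nat \<Rightarrow> 'a" and N :: int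
  shows "finite {\<Sum>i<n. int_scale (c i) (b i) | c. \<forall>i<n. \<bar>c i\<bar> \<le> N}"
proof (induction n)
  case (Suc n)
  let ?F = "\<lambda>n. {\<Sum>i<n. int_scale (c i) (b i) | c. \<forall>i<n. \<bar>c i\<bar> \<le> N}"
  have "?F (Suc n) \<subseteq> (\<lambda>(x, k). x + int_scale k (b n)) ` (?F n \<times> {-N..N})"
  proof
    fix x assume "x \<in> ?F (Suc n)"
    then obtain c where c: "x = (\<Sum>i<Suc n. int_scale (c i) (b i))" "\<forall>i<Suc n. \<bar>c i\<bar> \<le> N"
      by blast
    have "c n \<in> {-N..N}"
      using c(2) by (auto simp: abs_le_iff dest!: spec[of _ n])
    moreover have "(\<Sum>i<n. int_scale (c i) (b i)) \<in> ?F n"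
      using c(2) less_SucI by blast
    ultimately show "x \<in> (\<lambda>(x, k). x + int_scale k (b n)) ` (?F n \<times> {-N..N})"
      unfolding c(1) by (intro image_eqI[of _ _ "(\<Sum>i<n. int_scale (c i) (b i), c n)"]) auto
  qed
  then show ?case
    using Suc.IH by (meson finite_SigmaI finite_atLeastAtMost_int finite_imageI finite_subset)
qed simp

text \<open>The elements are chosen one after another: the first n avoid \<open>S\<close> minus
  \<open>D\<close>, the last avoids \<open>S\<close> minus the finitely many bounded combinations of
  the earlier ones. If d divides the last coefficient, the last term lies in \<open>D\<close> and
  the first choice applies; otherwise the second does.\<close>

lemma ex_generic_family:
  fixes S :: "'a set" and N :: int and n :: nat
  assumes "small S"
  shows "\<exists>b. \<forall>c. (\<forall>i<n. \<bar>c i\<bar> \<le> N) \<longrightarrow> (\<exists>i<n. \<not> int d dvd c i) \<longrightarrow>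
    (\<Sum>i<n. int_scale (c i) (b i)) \<notin> S"
  using assms
proof (induction n arbitrary: S)
  case (Suc n)
  have "small {x - y | x y. x \<in> S \<and> y \<in> D}"
    using Suc.prems small_D by (rule small_image2)
  from Suc.IH[OF this] obtain b where b: "\<And>c. \<forall>i<n. \<bar>c i\<bar> \<le> N \<Longrightarrow>
      \<exists>i<n. \<not> int d dvd c i \<Longrightarrow> (\<Sum>i<n. int_scale (c i) (b i)) \<notin> {x - y | x y. x \<in> S \<and> y \<in> D}"
    by blast
  let ?F = "{\<Sum>i<n. int_scale (c i) (b i) | c. \<forall>i<n. \<bar>c i\<bar> \<le> N}"
  have "small {x - y | x y. x \<in> S \<and> y \<in> ?F}"
    using Suc.prems small_finite[OF finite_bounded_combinations] by (rule small_image2)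
  from ex_generic_element[OF this, of N] obtain z
    where z: "\<And>c. \<bar>c\<bar> \<le> N \<Longrightarrow> \<not> int d dvd c \<Longrightarrow> int_scale c z \<notin> {x - y | x y. x \<in> S \<and> y \<in> ?F}"
    by blast
  have "(\<Sum>i<Suc n. int_scale (c i) ((b(n := z)) i)) \<notin> S"
    if c: "\<forall>i<Suc n. \<bar>c i\<bar> \<le> N" "\<exists>i<Suc n. \<not> int d dvd c i" for c
  proof
    let ?s = "\<Sum>i<n. int_scale (c i) (b i)"
    assume "(\<Sum>i<Suc n. int_scale (c i) ((b(n := z)) i)) \<in> S"
    then have S: "?s + int_scale (c n) z \<in> S"
      by simp
    show False
    proof (cases "int d dvd c n")
      case True
      then have "\<exists>i<n. \<not> int d dvd c i"
        using c(2) less_Suc_eq by metis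
      moreover have "?s = (?s + int_scale (c n) z) - int_scale (c n) z"
        by simp
      ultimately show False
        using b[of c] c(1) S int_scale_in_D[OF True, of z] less_SucI by blast
    next
      case False
      have "?s \<in> ?F"
        using c(1) less_SucI by blast
      moreover have "int_scale (c n) z = (?s + int_scale (c n) z) - ?s"
        by simp
      ultimately show False
        using z[of "c n"] False c(1) S by blast
    qed
  qed
  then show ?case by blast
qed simp

end

section \<open>Sums of h elements\<close>

lemma hfold_mono: "A \<subseteq> B \<Longrightarrow> hfold j A \<subseteq> hfold j B"
  unfolding hfold_def by blast

lemma hfold_0: "hfold 0 A = {0}"
  unfolding hfold_def by auto

lemma hfold_1: "hfold 1 A = A"
proof
  show "A \<subseteq> hfold 1 A"
    unfolding hfold_def by (auto intro!: exI[of _ "[_]"])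
qed (auto simp: hfold_def length_Suc_conv)

lemma hfold_Suc: "hfold (Suc j) A = {x + y | x y. x \<in> A \<and> y \<in> hfold j A}"
proof
  show "hfold (Suc j) A \<subseteq> {x + y | x y. x \<in> A \<and> y \<in> hfold j A}"
    unfolding hfold_def by (auto simp: length_Suc_conv) blast
  show "{x + y | x y. x \<in> A \<and> y \<in> hfold j A} \<subseteq> hfold (Suc j) A"
  proof clarify
    fix x y assume "x \<in> A" "y \<in> hfold j A"
    then obtain xs where "y = sum_list xs" "length xs = j" "set xs \<subseteq> A"
      unfolding hfold_def by blast
    with \<open>x \<in> A\<close> show "x + y \<in> hfold (Suc j) A"
      unfolding hfold_def by (auto intro!: exI[of _ "x # xs"])
  qed
qed

lemma sum_in_hfold: "(\<And>i. i < n \<Longrightarrow> b i \<in> A) \<Longrightarrow> (\<Sum>i<n. b i) \<in> hfold n A"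
  unfolding hfold_def
  by (rule CollectI, rule exI[of _ "map b [0..<n]"])
    (auto simp: interv_sum_list_conv_sum_set_nat atLeast0LessThan)

text \<open>\<open>n i\<close> counts the summands attributed to \<open>b i\<close>, and
  \<open>k\<close> those attributed to \<open>A\<close>. Where these overlap or the
  \<open>b i\<close> repeat, the attribution is an arbitrary choice.\<close>

lemma hfold_Un_image_cases:
  fixes b :: "nat \<Rightarrow> 'a::ab_group_add"
  assumes "x \<in> hfold j (A \<union> b ` {..<m})"
  obtains s k n where "x = s + (\<Sum>i<m. int_scale (int (n i)) (b i))" "s \<in> hfold k A"
    "k + (\<Sum>i<m. n i) = j"
proof -
  have "\<exists>s k n. x = s + (\<Sum>i<m. int_scale (int (n i)) (b i)) \<and> s \<in> hfold k A \<and>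
    k + (\<Sum>i<m. n i) = j"
    using assms
  proof (induction j arbitrary: x)
    case 0
    show ?case
      by (rule exI[of _ 0], rule exI[of _ 0], rule exI[of _ "\<lambda>_. 0"]) (use 0 in \<open>auto simp: hfold_0\<close>)
  next
    case (Suc j)
    then obtain y z where x: "x = y + z" and y: "y \<in> A \<union> b ` {..<m}"
      and z: "z \<in> hfold j (A \<union> b ` {..<m})"
      unfolding hfold_Suc by blast
    from Suc.IH[OF z] obtain s k n where IH: "z = s + (\<Sum>i<m. int_scale (int (n i)) (b i))"
      "s \<in> hfold k A" "k + (\<Sum>i<m. n i) = j"
      by blast
    from y show ?case
    proof
      assume "y \<in> A"
      then have "y + s \<in> hfold (Suc k) A"
        unfolding hfold_Suc using IH(2) by blast
      moreover have "x = (y + s) + (\<Sum>i<m. int_scale (int (n i)) (b i))"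
        by (simp add: x IH(1) add.assoc)
      moreover have "Suc k + (\<Sum>i<m. n i) = Suc j"
        using IH(3) by simp
      ultimately show ?thesis by blast
    next
      assume "y \<in> b ` {..<m}"
      then obtain l where l: "l < m" "y = b l"
        by blast
      define n' where "n' i = n i + (if i = l then 1 else 0)" for i
      have "(\<Sum>i<m. n' i) = (\<Sum>i<m. n i) + 1"
        unfolding n'_def using l by (simp add: sum.distrib)
      moreover have "(\<Sum>i<m. int_scale (int (n' i)) (b i)) =
          (\<Sum>i<m. int_scale (int (n i)) (b i) + (if i = l then y else 0))"
        unfolding n'_def using l by (intro sum.cong) (auto simp: int_scale.scale_left_distrib)
      then have "(\<Sum>i<m. int_scale (int (n' i)) (b i)) = (\<Sum>i<m. int_scale (int (n i)) (b i)) + y"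
        using l by (simp add: sum.distrib)
      ultimately show ?thesis
        using IH by (intro exI[of _ s] exI[of _ k] exI[of _ n']) (auto simp: x algebra_simps)
    qed
  qed
  then show ?thesis
    using that by blast
qed

section \<open>Protected elements\<close>

locale basis_construction = torsion_modulus ty d for ty :: "'a::ab_group_add itself" and d +
  fixes h :: nat
  assumes h_ge_2: "2 \<le> h"
begin

text \<open>The second condition is needed up to \<^term>\<open>D\<close> because later summands may cancel modulo
  \<^term>\<open>D\<close>; it also keeps the order of the basis from dropping below \<^term>\<open>h\<close>.\<close>

definition protected :: "'a set \<Rightarrow> 'a \<Rightarrow> 'a \<Rightarrow> bool" where
  "protected A a p \<longleftrightarrow> p \<notin> hfold h (A - {a}) \<and> (\<forall>j<h. \<forall>s\<in>hfold j A. p - s \<notin> D)"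

text \<open>If a sum over an extended set reaches p up to an element y of \<open>D\<close>, and s is
  its part from \<open>A\<close>, then the new summands contribute exactly p - s - y. These are the
  values that contributions of new elements should avoid.\<close>

definition critical :: "'a set \<Rightarrow> 'a set \<Rightarrow> 'a set" where
  "critical P A = {x - y | x y. x \<in> {p - s | p s. p \<in> P \<and> s \<in> (\<Union>j\<in>{..h}. hfold j A)} \<and> y \<in> D}"

lemma criticalI: "p \<in> P \<Longrightarrow> s \<in> hfold j A \<Longrightarrow> j \<le> h \<Longrightarrow> y \<in> D \<Longrightarrow> p - s - y \<in> critical P A"
  unfolding critical_def by blast

lemma small_hfold: "small A \<Longrightarrow> small (hfold j A)" for A :: "'a set"
  by (induction j) (auto simp: hfold_0 hfold_Suc intro: small_finite small_image2)

lemma small_critical: "small P \<Longrightarrow> small A \<Longrightarrow> small (critical P A)"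
  unfolding critical_def
  by (intro small_image2 small_Union_finite small_hfold small_D) auto

text \<open>A sum that violates protection has only finitely many summands. This carries protection
  through limit stages.\<close>

lemma protectedI_finite:
  assumes "\<And>F. finite F \<Longrightarrow> F \<subseteq> A \<Longrightarrow> protected F a p"
  shows "protected A a p"
  unfolding protected_def
proof (intro conjI allI impI ballI notI)
  assume "p \<in> hfold h (A - {a})"
  then obtain xs where xs: "p = sum_list xs" "length xs = h" "set xs \<subseteq> A - {a}"
    unfolding hfold_def by blast
  then have "p \<in> hfold h (set xs - {a})"
    unfolding hfold_def by blast
  then show False
    using assms[of "set xs"] xs(3) unfolding protected_def by auto
next
  fix j s assume j: "j < h" and s: "s \<in> hfold j A" and D: "p - s \<in> D"
  from s obtain xs where xs: "s = sum_list xs" "length xs = j" "set xs \<subseteq> A"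
    unfolding hfold_def by blast
  then have "s \<in> hfold j (set xs)"
    unfolding hfold_def by blast
  then show False
    using assms[of "set xs"] xs(3) j D unfolding protected_def by auto
qed

lemma protected_antimono: "protected B a p \<Longrightarrow> A \<subseteq> B \<Longrightarrow> protected A a p"
  unfolding protected_def using hfold_mono by (metis Diff_mono order_refl subsetD)

text \<open>Hypothesis \<open>n\<close> leaves three cases. Multiplicities divisible by d contribute
  an element of \<open>D\<close>, so the old part already reaches p modulo \<open>D\<close> with
  fewer summands, or no new summand occurs at all. A noncritical contribution completes no old sum
  to p. If all h summands are new, their sum differs from p.\<close>

lemma protected_Un_image:
  fixes b :: "nat \<Rightarrow> 'a"
  assumes A: "protected A a p" and p: "p \<in> P"
    and n: "\<And>n. (\<Sum>i<m. n i) \<le> h \<Longrightarrow> (\<forall>i<m. d dvd n i) \<or>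
      (\<Sum>i<m. int_scale (int (n i)) (b i)) \<notin> critical P A \<or>
      (\<Sum>i<m. n i) = h \<and> (\<Sum>i<m. int_scale (int (n i)) (b i)) \<noteq> p"
  shows "protected (A \<union> b ` {..<m}) a p"
  unfolding protected_def
proof (intro conjI allI impI ballI notI)
  assume "p \<in> hfold h (A \<union> b ` {..<m} - {a})"
  then have "p \<in> hfold h ((A - {a}) \<union> b ` {..<m})"
    by (rule subsetD[OF hfold_mono, rotated]) blast
  then obtain s k n where split: "p = s + (\<Sum>i<m. int_scale (int (n i)) (b i))"
    "s \<in> hfold k (A - {a})" "k + (\<Sum>i<m. n i) = h"
    by (rule hfold_Un_image_cases)
  let ?C = "\<Sum>i<m. int_scale (int (n i)) (b i)"
  have s: "s \<in> hfold k A"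
    using split(2) hfold_mono[of "A - {a}" A k] by blast
  consider "\<forall>i<m. d dvd n i" | "?C \<notin> critical P A" | "(\<Sum>i<m. n i) = h" "?C \<noteq> p"
    using n[OF le_add2[of "\<Sum>i<m. n i" k, unfolded split(3)]] by blast
  then show False
  proof cases
    case 1
    then have C: "?C \<in> D"
      by (intro sum_in_D int_scale_in_D) auto
    show False
    proof (cases "k = h")
      case True
      then have "\<forall>i<m. n i = 0"
        using split(3) by simp
      then have "p = s"
        using split(1) by simp
      then show False
        using A split(2) True unfolding protected_def by blast
    next
      case False
      then have "k < h"
        using split(3) by linarith
      moreover have "p - s \<in> D"
        using C split(1) by simp
      ultimately show False
        using A s unfolding protected_def by blast
    qed
  next
    case 2
    have "p - s - 0 \<in> critical P A"
      using p s split(3) by (intro criticalI zero_in_D) auto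
    then show False
      using 2 split(1) by simp
  next
    case 3
    then show False
      using split by (simp add: hfold_0)
  qed
next
  fix j s' assume j: "j < h" and s': "s' \<in> hfold j (A \<union> b ` {..<m})" and D: "p - s' \<in> D"
  from s' obtain s k n where split: "s' = s + (\<Sum>i<m. int_scale (int (n i)) (b i))"
    "s \<in> hfold k A" "k + (\<Sum>i<m. n i) = j"
    by (rule hfold_Un_image_cases)
  let ?C = "\<Sum>i<m. int_scale (int (n i)) (b i)"
  \<comment> \<open>Fewer than h summands are available, so the third alternative of
    \<open>n\<close> cannot occur.\<close>
  have "(\<Sum>i<m. n i) < h"
    using split(3) j by linarith
  then consider "\<forall>i<m. d dvd n i" | "?C \<notin> critical P A"
    using n[of n] by fastforce
  then show False
  proof cases
    case 1
    then have "?C \<in> D"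
      by (intro sum_in_D int_scale_in_D) auto
    then have "(p - s') + ?C \<in> D"
      using D by (intro add_in_D)
    then have "p - s \<in> D"
      using split(1) by (simp add: algebra_simps)
    moreover have "k < h"
      using split(3) j by linarith
    ultimately show False
      using A split(2) unfolding protected_def by blast
  next
    case 2
    have "p - s - (p - s') \<in> critical P A"
      using p split j D by (intro criticalI) auto
    moreover have "p - s - (p - s') = ?C"
      using split(1) by simp
    ultimately show False
      using 2 by simp
  qed
qed

text \<open>The new summands are h - 1 generic elements and g minus their sum. Eliminating the last
  one subtracts its multiplicity from all others, so a critical contribution requires multiplicities
  that agree modulo d. If they are not divisible by d, the new summands add up to g itself.\<close>

lemma ex_extension_representing:
  fixes A P :: "'a set"
  assumes A: "small A" "A \<inter> D = {}" and P: "small P" "P \<subseteq> hfold h A"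
  shows "\<exists>B. finite B \<and> B \<inter> D = {} \<and> g \<in> hfold h (A \<union> B) \<and>
    (\<forall>a. \<forall>p\<in>P. protected A a p \<longrightarrow> protected (A \<union> B) a p)"
proof (cases "g \<in> hfold h A")
  case True
  then show ?thesis
    by (intro exI[of _ "{}"]) auto
next
  case False
  define k where "k = h - 1"
  have k: "h = Suc k" "k > 0"
    using h_ge_2 by (auto simp: k_def)
  \<comment> \<open>The translates compensate for the multiple of g brought in by the last summand;
    \<open>D\<close> and g - \<open>D\<close> keep the new elements outside
    \<open>D\<close>.\<close>
  define S where "S = (\<Union>n\<in>{..h}. (\<lambda>x. x - int_scale (int n) g) ` critical P A) \<union> (D \<union> (\<lambda>y. g - y) ` D)"
  have "small S"
    unfolding S_def using A(1) P(1)
    by (intro small_Un small_Union_finite small_image small_D small_critical) auto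
  from ex_generic_family[OF this, of k "int h"] obtain b where b:
    "\<And>c. \<forall>i<k. \<bar>c i\<bar> \<le> int h \<Longrightarrow> \<exists>i<k. \<not> int d dvd c i \<Longrightarrow> (\<Sum>i<k. int_scale (c i) (b i)) \<notin> S"
    by blast
  define b' where "b' = b(k := g - (\<Sum>i<k. b i))"
  have sum_b': "(\<Sum>i<h. b' i) = g"
    by (simp add: k(1) b'_def)
  have comb: "(\<Sum>i<h. int_scale (int (n i)) (b' i)) =
      (\<Sum>i<k. int_scale (int (n i) - int (n k)) (b i)) + int_scale (int (n k)) g" for n
    by (simp add: k(1) b'_def int_scale.scale_left_diff_distrib int_scale.scale_right_diff_distrib
        int_scale.scale_sum_right sum_subtractf)
  \<comment> \<open>Genericity applies to coefficients that are all 1, or 1 at a single place,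
    because d differs from 1.\<close>
  have not_D: "b' j \<notin> D" if "j < h" for j
  proof (cases "j = k")
    case True
    have "(\<Sum>i<k. int_scale 1 (b i)) \<notin> S"
      using b[of "\<lambda>_. 1"] k not_modulus_dvd_1 by auto
    then have *: "(\<Sum>i<k. b i) \<notin> (\<lambda>y. g - y) ` D"
      by (simp add: S_def)
    show ?thesis
    proof
      assume "b' j \<in> D"
      then have "g - b' j \<in> (\<lambda>y. g - y) ` D"
        by blast
      then show False
        using * True by (simp add: b'_def)
    qed
  next
    case False
    then have "j < k"
      using that k by simp
    have "(\<Sum>i<k. int_scale (if i = j then 1 else 0) (b i)) \<notin> S"
      using b[of "\<lambda>i. if i = j then 1 else 0"] \<open>j < k\<close> k not_modulus_dvd_1 by auto
    moreover have "(\<Sum>i<k. int_scale (if i = j then 1 else 0) (b i)) = (\<Sum>i<k. if i = j then b i else 0)"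
      by (intro sum.cong) auto
    ultimately have "b j \<notin> S"
      using \<open>j < k\<close> by simp
    then show ?thesis
      using False by (simp add: S_def b'_def)
  qed
  have protected: "protected (A \<union> b' ` {..<h}) a p" if "p \<in> P" "protected A a p" for a p
    using that(2,1)
  proof (rule protected_Un_image)
    fix n :: "nat \<Rightarrow> nat"
    assume sum_le: "(\<Sum>i<h. n i) \<le> h"
    have n_le: "n i \<le> h" if "i < h" for i
      using member_le_sum[of i "{..<h}" n] that sum_le by simp
    show "(\<forall>i<h. d dvd n i) \<or> (\<Sum>i<h. int_scale (int (n i)) (b' i)) \<notin> critical P A \<or>
      (\<Sum>i<h. n i) = h \<and> (\<Sum>i<h. int_scale (int (n i)) (b' i)) \<noteq> p"
    proof (cases "\<exists>i<k. \<not> int d dvd int (n i) - int (n k)")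
      case True
      have "\<forall>i<k. \<bar>int (n i) - int (n k)\<bar> \<le> int h"
      proof (intro allI impI)
        fix i assume "i < k"
        then have "n i \<le> h" "n k \<le> h"
          using n_le k by auto
        then show "\<bar>int (n i) - int (n k)\<bar> \<le> int h"
          by linarith
      qed
      then have "(\<Sum>i<k. int_scale (int (n i) - int (n k)) (b i)) \<notin> S"
        by (rule b[OF _ True])
      then have *: "(\<Sum>i<k. int_scale (int (n i) - int (n k)) (b i)) \<notin>
          (\<lambda>x. x - int_scale (int (n k)) g) ` critical P A"
        using n_le[of k] k unfolding S_def by blast
      have "(\<Sum>i<h. int_scale (int (n i)) (b' i)) \<notin> critical P A"
      proof
        assume "(\<Sum>i<h. int_scale (int (n i)) (b' i)) \<in> critical P A"
        then have "(\<Sum>i<h. int_scale (int (n i)) (b' i)) - int_scale (int (n k)) g \<in>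
            (\<lambda>x. x - int_scale (int (n k)) g) ` critical P A"
          by blast
        then show False
          using * unfolding comb by simp
      qed
      then show ?thesis by blast
    next
      case False
      then have cong: "int d dvd int (n i) - int (n k)" if "i < k" for i
        using that by blast
      have dvd_iff: "d dvd n i \<longleftrightarrow> d dvd n k" if "i < h" for i
      proof (cases "i = k")
        case False
        then have "int d dvd (int (n i) - int (n k)) + int (n k) \<longleftrightarrow> int d dvd int (n k)"
          using cong[of i] that k by (intro dvd_add_right_iff) auto
        then show ?thesis by simp
      qed simp
      show ?thesis
      proof (cases "d dvd n k")
        case True
        then show ?thesis
          using dvd_iff by blast
      next
        case ndvd: False
        \<comment> \<open>A multiplicity not divisible by d is nonzero. All h new elements then
          occur, and with at most h summands each occurs exactly once.\<close>
        have pos: "n i \<ge> 1" if "i < h" for i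
          using dvd_iff[OF that] ndvd by (cases "n i") auto
        have "(\<Sum>i<h. n i) = h"
          using sum_mono[of "{..<h}" "\<lambda>_. 1" n] pos sum_le by auto
        moreover have "(\<Sum>i<h. n i - 1) = (\<Sum>i<h. n i) - (\<Sum>i<h. 1)"
          by (rule sum_subtractf_nat) (use pos in auto)
        ultimately have "(\<Sum>i<h. n i - 1) = 0"
          by simp
        then have "n i = 1" if "i < h" for i
          using that pos[OF that] by (simp add: le_antisym)
        then have "(\<Sum>i<h. int_scale (int (n i)) (b' i)) = g"
          by (simp add: sum_b')
        \<comment> \<open>In this case g lies outside hA, while all of \<open>P\<close> lies inside
          hA.\<close>
        moreover have "g \<noteq> p"
          using False \<open>p \<in> P\<close> P(2) \<open>g \<notin> hfold h A\<close> by blast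
        ultimately show ?thesis
          using \<open>(\<Sum>i<h. n i) = h\<close> by simp
      qed
    qed
  qed
  have "(\<Sum>i<h. b' i) \<in> hfold h (A \<union> b' ` {..<h})"
    by (rule sum_in_hfold) auto
  then have "g \<in> hfold h (A \<union> b' ` {..<h})"
    unfolding sum_b' .
  then show ?thesis
    using not_D protected by (intro exI[of _ "b' ` {..<h}"]) auto
qed

text \<open>The new protected element is a plus h - 1 generic elements. Reaching it modulo
  \<open>D\<close> with at most h summands forces each generic element to occur exactly once, which
  leaves room for at most one summand from \<open>A\<close>.\<close>

lemma ex_extension_protecting:
  fixes A P :: "'a set"
  assumes A: "small A" "A \<inter> D = {}" and P: "small P" and a: "a \<in> A"
  shows "\<exists>B p. finite B \<and> B \<inter> D = {} \<and> p \<notin> P \<and> p \<in> hfold h (A \<union> B) \<and> protected (A \<union> B) a p \<and>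
    (\<forall>a. \<forall>p\<in>P. protected A a p \<longrightarrow> protected (A \<union> B) a p)"
proof -
  define k where "k = h - 1"
  have k: "h = Suc k" "k > 0"
    using h_ge_2 by (auto simp: k_def)
  \<comment> \<open>The four parts respectively preserve old protection, control the ways to reach
    the new \<open>p\<close>, keep the new elements outside \<open>D\<close>, and keep
    \<open>p\<close> outside \<open>P\<close>.\<close>
  define S where "S = critical P A \<union> critical {a} A \<union> D \<union> (\<lambda>p. p - a) ` P"
  have "small S"
    unfolding S_def using A(1) P
    by (intro small_Un small_image small_D small_critical) (auto intro: small_finite)
  from ex_generic_family[OF this, of k "int h"] obtain b where b:
    "\<And>c. \<forall>i<k. \<bar>c i\<bar> \<le> int h \<Longrightarrow> \<exists>i<k. \<not> int d dvd c i \<Longrightarrow> (\<Sum>i<k. int_scale (c i) (b i)) \<notin> S"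
    by blast
  define p where "p = a + (\<Sum>i<k. b i)"
  let ?B = "b ` {..<k}"
  have not_D: "b j \<notin> D" if "j < k" for j
  proof -
    have "(\<Sum>i<k. int_scale (if i = j then 1 else 0) (b i)) \<notin> S"
      using b[of "\<lambda>i. if i = j then 1 else 0"] that k not_modulus_dvd_1 by auto
    moreover have "(\<Sum>i<k. int_scale (if i = j then 1 else 0) (b i)) = (\<Sum>i<k. if i = j then b i else 0)"
      by (intro sum.cong) auto
    ultimately show ?thesis
      using that by (simp add: S_def)
  qed
  have "p \<notin> P"
  proof
    assume "p \<in> P"
    then have "p - a \<in> S"
      unfolding S_def by blast
    then have "(\<Sum>i<k. int_scale 1 (b i)) \<in> S"
      by (simp add: p_def)
    then show False
      using b[of "\<lambda>_. 1"] k not_modulus_dvd_1 by auto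
  qed
  have "a + (\<Sum>i<k. b i) \<in> hfold (Suc k) (A \<union> ?B)"
    unfolding hfold_Suc using a sum_in_hfold[of k b "A \<union> ?B"] by blast
  then have "p \<in> hfold h (A \<union> ?B)"
    unfolding p_def k(1) .
  \<comment> \<open>Subtracting the defining sum of \<open>p\<close> leaves coefficients n_i - 1 and
    a value critical for a, so d divides n_i - 1. Thus n_i is nonzero, and h - 1 positive
    multiplicities leave at most one spare summand; n_i = 2 would make d equal to 1.\<close>
  have coeffs: "\<forall>i<k. n i = 1"
    if s: "s \<in> hfold l A" and l: "l + (\<Sum>i<k. n i) \<le> h" and y: "y \<in> D"
      and eq: "p = s + (\<Sum>i<k. int_scale (int (n i)) (b i)) + y" for s l n y
  proof -
    have n_le: "n i \<le> h" if "i < k" for i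
      using member_le_sum[of i "{..<k}" n] that l by simp
    have "(\<Sum>i<k. int_scale (int (n i) - 1) (b i)) = a - s - y"
      using eq by (simp add: p_def int_scale.scale_left_diff_distrib sum_subtractf algebra_simps)
    then have "(\<Sum>i<k. int_scale (int (n i) - 1) (b i)) \<in> S"
      using criticalI[of a "{a}" s l A y] s l y by (simp add: S_def)
    moreover have "\<forall>i<k. \<bar>int (n i) - 1\<bar> \<le> int h"
    proof (intro allI impI)
      fix i assume "i < k"
      then show "\<bar>int (n i) - 1\<bar> \<le> int h"
        using n_le[of i] k by linarith
    qed
    ultimately have dvd: "int d dvd int (n i) - 1" if "i < k" for i
      using b[of "\<lambda>i. int (n i) - 1"] that by blast
    have pos: "n i \<ge> 1" if "i < k" for i
      using dvd[OF that] not_modulus_dvd_1 by (cases "n i") auto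
    show ?thesis
    proof (intro allI impI)
      fix i assume i: "i < k"
      have "(\<Sum>i<k. n i - 1) = (\<Sum>i<k. n i) - (\<Sum>i<k. 1)"
        by (rule sum_subtractf_nat) (use pos in auto)
      then have "(\<Sum>i<k. n i - 1) \<le> 1"
        using l k by simp
      then have "n i - 1 \<le> 1"
        using member_le_sum[of i "{..<k}" "\<lambda>i. n i - 1"] i by simp
      moreover have "n i \<noteq> 2"
        using dvd[OF i] not_modulus_dvd_1 by auto
      ultimately show "n i = 1"
        using pos[OF i] by linarith
    qed
  qed
  have "protected (A \<union> ?B) a p"
    unfolding protected_def
  proof (intro conjI allI impI ballI notI)
    assume "p \<in> hfold h (A \<union> ?B - {a})"
    then have "p \<in> hfold h ((A - {a}) \<union> ?B)"
      by (rule subsetD[OF hfold_mono, rotated]) blast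
    then obtain s l n where split: "p = s + (\<Sum>i<k. int_scale (int (n i)) (b i))"
      "s \<in> hfold l (A - {a})" "l + (\<Sum>i<k. n i) = h"
      by (rule hfold_Un_image_cases)
    have "s \<in> hfold l A"
      using split(2) hfold_mono[of "A - {a}" A l] by blast
    then have n: "\<forall>i<k. n i = 1"
      using split by (intro coeffs[of s l n 0]) (auto simp: zero_in_D)
    \<comment> \<open>The single remaining summand would have to be a, which has been
      removed.\<close>
    then have "l = 1" "p = s + (\<Sum>i<k. b i)"
      using split k by auto
    then show False
      using split(2) by (simp add: p_def hfold_1[unfolded One_nat_def])
  next
    fix j s' assume j: "j < h" and s': "s' \<in> hfold j (A \<union> ?B)" and D: "p - s' \<in> D"
    from s' obtain s l n where split: "s' = s + (\<Sum>i<k. int_scale (int (n i)) (b i))"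
      "s \<in> hfold l A" "l + (\<Sum>i<k. n i) = j"
      by (rule hfold_Un_image_cases)
    have n: "\<forall>i<k. n i = 1"
      using split j D by (intro coeffs[of s l n "p - s'"]) auto
    \<comment> \<open>No summand from \<open>A\<close> remains, so p - s' equals a; here the
      disjointness of \<open>A\<close> from \<open>D\<close> gives the contradiction.\<close>
    then have "l = 0" "s' = s + (\<Sum>i<k. b i)"
      using split k j by auto
    then have "a \<in> D"
      using split(2) D by (simp add: p_def hfold_0)
    then show False
      using a A(2) by blast
  qed
  moreover have "protected (A \<union> ?B) a' p'" if "p' \<in> P" "protected A a' p'" for a' p'
    using that(2,1)
  proof (rule protected_Un_image)
    fix n :: "nat \<Rightarrow> nat"
    assume sum_le: "(\<Sum>i<k. n i) \<le> h"
    have "\<forall>i<k. \<bar>int (n i)\<bar> \<le> int h"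
      using member_le_sum[of _ "{..<k}" n] sum_le by fastforce
    then show "(\<forall>i<k. d dvd n i) \<or> (\<Sum>i<k. int_scale (int (n i)) (b i)) \<notin> critical P A \<or>
      (\<Sum>i<k. n i) = h \<and> (\<Sum>i<k. int_scale (int (n i)) (b i)) \<noteq> p'"
      using b[of "\<lambda>i. int (n i)"] unfolding S_def by auto
  qed
  ultimately show ?thesis
    using not_D \<open>p \<notin> P\<close> \<open>p \<in> hfold h (A \<union> ?B)\<close> by (intro exI[of _ ?B] exI[of _ p]) auto
qed

end

section \<open>The transfinite construction\<close>

text \<open>Finitely many stages supply the elements of \<open>F\<close>; the largest among these
  and y serves as z. Being at or after y, it is a stage where protection of the elements from stage
  y is known.\<close>

lemma finite_subset_initial_Union:
  assumes total: "\<And>x y. x \<noteq> y \<Longrightarrow> (x, y) \<in> R \<or> (y, x) \<in> R" and "trans R"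
    and "finite F" "F \<subseteq> (\<Union>z\<in>W. B z)" and y: "y \<in> W"
  shows "\<exists>z\<in>W. (z = y \<or> (y, z) \<in> R) \<and> F \<subseteq> (\<Union>w\<in>{w. (w, z) \<in> R}. B w) \<union> B z"
  using assms(3,4)
proof (induction F rule: finite_induct)
  case empty
  then show ?case
    using y by blast
next
  case (insert v F)
  then obtain z where z: "z \<in> W" "z = y \<or> (y, z) \<in> R"
    "F \<subseteq> (\<Union>w\<in>{w. (w, z) \<in> R}. B w) \<union> B z"
    by auto
  from insert.prems obtain u where u: "u \<in> W" "v \<in> B u"
    by blast
  show ?case
  proof (cases "(z, u) \<in> R")
    case True
    then have "y = u \<or> (y, u) \<in> R"
      using z(2) \<open>trans R\<close> by (auto dest: transD)
    moreover have "(\<Union>w\<in>{w. (w, z) \<in> R}. B w) \<union> B z \<subseteq> (\<Union>w\<in>{w. (w, u) \<in> R}. B w)"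
      using True \<open>trans R\<close> by (auto dest: transD)
    then have "F \<subseteq> (\<Union>w\<in>{w. (w, u) \<in> R}. B w)"
      using z(3) by (rule order_trans[rotated])
    ultimately show ?thesis
      using u by (intro bexI[of _ u]) auto
  next
    case False
    then have "u = z \<or> (u, z) \<in> R"
      using total by blast
    then have "v \<in> (\<Union>w\<in>{w. (w, z) \<in> R}. B w) \<union> B z"
      using u(2) by blast
    then show ?thesis
      using z by (intro bexI[of _ z]) auto
  qed
qed

context basis_construction
begin

text \<open>First g is represented; then, if it already belongs to \<open>A\<close>, one fresh
  element is protected for it.\<close>

lemma ex_stage:
  fixes A P :: "'a set"
  assumes A: "small A" "A \<inter> D = {}" and P: "small P" "P \<subseteq> hfold h A"
  shows "\<exists>B Q. finite B \<and> finite Q \<and> B \<inter> D = {} \<and> Q \<inter> P = {} \<and> Q \<subseteq> hfold h (A \<union> B) \<and>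
    g \<in> hfold h (A \<union> B) \<and> (g \<in> A \<longrightarrow> Q \<noteq> {}) \<and> (\<forall>q\<in>Q. protected (A \<union> B) g q) \<and>
    (\<forall>a. \<forall>p\<in>P. protected A a p \<longrightarrow> protected (A \<union> B) a p)"
proof -
  from ex_extension_representing[OF A P, of g] obtain B where B: "finite B" "B \<inter> D = {}"
    "g \<in> hfold h (A \<union> B)" "\<And>a p. p \<in> P \<Longrightarrow> protected A a p \<Longrightarrow> protected (A \<union> B) a p"
    by blast
  show ?thesis
  proof (cases "g \<in> A")
    case False
    then show ?thesis
      using B by (intro exI[of _ B] exI[of _ "{}"]) simp
  next
    case True
    have "small (A \<union> B)"
      using A(1) small_finite[OF B(1)] by (rule small_Un)
    moreover have "(A \<union> B) \<inter> D = {}"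
      using A(2) B(2) by blast
    moreover have "g \<in> A \<union> B"
      using True by blast
    ultimately obtain B' p where B': "finite B'" "B' \<inter> D = {}" "p \<notin> P"
      "p \<in> hfold h (A \<union> B \<union> B')" "protected (A \<union> B \<union> B') g p"
      "\<And>a p. p \<in> P \<Longrightarrow> protected (A \<union> B) a p \<Longrightarrow> protected (A \<union> B \<union> B') a p"
      using ex_extension_protecting[of "A \<union> B" P g] P(1) by blast
    have "g \<in> hfold h (A \<union> (B \<union> B'))"
      by (rule subsetD[OF hfold_mono B(3)]) blast
    then show ?thesis
      using B B' by (intro exI[of _ "B \<union> B'"] exI[of _ "{p}"]) (auto simp: Un_assoc)
  qed
qed

text \<open>\<open>Z\<close> collects one protected element from each stage scheduled for a after a
  has entered. Its disjointness from jA for j < h will keep the order from dropping below h.\<close>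

lemma ex_strongly_minimal_basis:
  "\<exists>A :: 'a set. hfold h A = UNIV \<and>
    (\<forall>a\<in>A. \<exists>Z. infinite Z \<and> Z \<inter> hfold h (A - {a}) = {} \<and> (\<forall>j<h. Z \<inter> hfold j A = {}))"
proof -
  obtain t :: "'a \<Rightarrow> 'a" where t: "\<And>a. \<not> small {x. t x = a}"
    using ex_map_with_large_fibers by blast
  have surj_t: "\<exists>x. t x = g" for g
  proof (rule ccontr)
    assume "\<nexists>x. t x = g"
    then have "{x. t x = g} = {}"
      by simp
    then show False
      using t[of g] small_finite[of "{}"] by simp
  qed
  \<comment> \<open>The strict part of a cardinal well-order, whose initial segments are all
    small.\<close>
  define R where "R = |UNIV :: 'a set| - Id"
  have wo: "well_order_on UNIV |UNIV :: 'a set|"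
    by (rule card_of_well_order_on)
  then have "wf R"
    unfolding R_def well_order_on_def by blast
  have "trans R"
    using wo unfolding R_def well_order_on_def linear_order_on_def partial_order_on_def preorder_on_def
    by (auto intro: trans_diff_Id)
  have total: "(x, y) \<in> R \<or> (y, x) \<in> R" if "x \<noteq> y" for x y
    using wo that unfolding R_def well_order_on_def linear_order_on_def total_on_def by auto
  have small_below: "small {y. (y, x) \<in> R}" for x
  proof -
    have "{y. (y, x) \<in> R} = underS |UNIV :: 'a set| x"
      unfolding R_def underS_def by auto
    then show ?thesis
      unfolding small_def using card_of_underS[OF card_of_Card_order[of "UNIV :: 'a set"], of x] by (simp add: Field_card_of)
  qed
  \<comment> \<open>A stage yields a pair: the elements added to the basis, and those now protected for \<open>t x\<close>.\<close>
  define below :: "('a \<Rightarrow> 'a set) \<Rightarrow> 'a \<Rightarrow> 'a set" where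
    "below F x = (\<Union>y\<in>{y. (y, x) \<in> R}. F y)" for F x
  define stage :: "('a \<Rightarrow> 'a set \<times> 'a set) \<Rightarrow> 'a \<Rightarrow> 'a set \<times> 'a set \<Rightarrow> bool" where
    "stage f x r \<longleftrightarrow> (let A = below (fst \<circ> f) x; P = below (snd \<circ> f) x; B = fst r; Q = snd r in
      finite B \<and> finite Q \<and> B \<inter> D = {} \<and> Q \<inter> P = {} \<and> Q \<subseteq> hfold h (A \<union> B) \<and>
      t x \<in> hfold h (A \<union> B) \<and> (t x \<in> A \<longrightarrow> Q \<noteq> {}) \<and> (\<forall>q\<in>Q. protected (A \<union> B) (t x) q) \<and>
      (\<forall>y. (y, x) \<in> R \<longrightarrow> (\<forall>q\<in>snd (f y). protected (A \<union> B) (t y) q)))" for f x r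
  \<comment> \<open>Each stage guarantees protection only within the set built so far. A violation
    in the union uses finitely many elements and would already appear at a stage of \<open>W\<close>
    not before y.\<close>
  have limit: "protected (\<Union>z\<in>W. fst (f z)) (t y) q"
    if f: "\<And>z. z \<in> W \<Longrightarrow> stage f z (f z)" and y: "y \<in> W" and q: "q \<in> snd (f y)" for f W y q
  proof (rule protectedI_finite)
    fix F assume "finite F" "F \<subseteq> (\<Union>z\<in>W. fst (f z))"
    from finite_subset_initial_Union[OF total \<open>trans R\<close> this y] obtain z
      where z: "z \<in> W" "z = y \<or> (y, z) \<in> R" "F \<subseteq> below (fst \<circ> f) z \<union> fst (f z)"
      by (auto simp: below_def)
    have "protected (below (fst \<circ> f) z \<union> fst (f z)) (t y) q"
      using z(2) f[OF z(1)] q unfolding stage_def Let_def by blast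
    then show "protected F (t y) q"
      using z(3) by (rule protected_antimono)
  qed
  have "\<exists>f. \<forall>x. stage f x (f x)"
  \<comment> \<open>The predicate \<open>stage f x\<close> consults \<open>f\<close> only below x,
    so a solution can be chosen by well-founded recursion.\<close>
  proof (rule dependent_wf_choice[OF \<open>wf R\<close>])
    fix f g :: "'a \<Rightarrow> 'a set \<times> 'a set" and x r
    assume "\<And>z. (z, x) \<in> R \<Longrightarrow> f z = g z"
    then show "stage f x r = stage g x r"
      unfolding stage_def below_def by simp
  next
    fix x and f :: "'a \<Rightarrow> 'a set \<times> 'a set"
    assume f: "\<And>y. (y, x) \<in> R \<Longrightarrow> stage f y (f y)"
    let ?A = "below (fst \<circ> f) x" and ?P = "below (snd \<circ> f) x"
    have "small ?A" "small ?P"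
      unfolding below_def using f small_below
      by (auto intro!: small_Union_of_finite simp: stage_def Let_def)
    moreover have "?A \<inter> D = {}"
      using f unfolding below_def stage_def Let_def by fastforce
    \<comment> \<open>This invariant ensures that a still unrepresented g is never a protected
      element.\<close>
    moreover have "?P \<subseteq> hfold h ?A"
    proof
      fix q assume "q \<in> ?P"
      then obtain y where y: "(y, x) \<in> R" "q \<in> snd (f y)"
        unfolding below_def by auto
      then have "q \<in> hfold h (below (fst \<circ> f) y \<union> fst (f y))"
        using f[OF y(1)] unfolding stage_def Let_def by blast
      moreover have "below (fst \<circ> f) y \<union> fst (f y) \<subseteq> ?A"
        using y(1) \<open>trans R\<close> unfolding below_def by (auto dest: transD)
      ultimately show "q \<in> hfold h ?A"
        using hfold_mono by blast
    qed
    ultimately obtain B Q where BQ: "finite B" "finite Q" "B \<inter> D = {}" "Q \<inter> ?P = {}"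
      "Q \<subseteq> hfold h (?A \<union> B)" "t x \<in> hfold h (?A \<union> B)" "t x \<in> ?A \<longrightarrow> Q \<noteq> {}"
      "\<forall>q\<in>Q. protected (?A \<union> B) (t x) q"
      "\<forall>a. \<forall>p\<in>?P. protected ?A a p \<longrightarrow> protected (?A \<union> B) a p"
      using ex_stage[of ?A ?P "t x"] by blast
    have "protected (?A \<union> B) (t y) q" if y: "(y, x) \<in> R" "q \<in> snd (f y)" for y q
    proof -
      have "protected ?A (t y) q"
        using limit[of "{y. (y, x) \<in> R}" f y q] f y by (simp add: below_def)
      moreover have "q \<in> ?P"
        using y unfolding below_def by auto
      ultimately show ?thesis
        using BQ(9) by blast
    qed
    then have "stage f x (B, Q)"
      using BQ unfolding stage_def Let_def by simp
    then show "\<exists>r. stage f x r" ..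
  qed
  then obtain f where f: "\<And>x. stage f x (f x)"
    by blast
  define A where "A = (\<Union>x. fst (f x))"
  have protected: "protected A (t x) q" if "q \<in> snd (f x)" for x q
    using limit[of UNIV f x q] f that by (simp add: A_def)
  have "g \<in> hfold h A" for g
  proof -
    obtain x where x: "t x = g"
      using surj_t by (rule exE)
    have "below (fst \<circ> f) x \<union> fst (f x) \<subseteq> A"
      unfolding below_def A_def by auto
    moreover have "g \<in> hfold h (below (fst \<circ> f) x \<union> fst (f x))"
      using f[of x] x unfolding stage_def Let_def by blast
    ultimately show ?thesis
      using hfold_mono by blast
  qed
  moreover have "\<exists>Z. infinite Z \<and> Z \<inter> hfold h (A - {a}) = {} \<and> (\<forall>j<h. Z \<inter> hfold j A = {})"
    if "a \<in> A" for a
  proof -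
    from that obtain z where z: "a \<in> fst (f z)"
      unfolding A_def by blast
    \<comment> \<open>A stage protects something for a only once a is present, so stages up to z are
      dropped. They form a small set, while the fiber of \<open>t\<close> over a is not
      small.\<close>
    define X where "X = {x. t x = a \<and> (z, x) \<in> R}"
    have "infinite X"
    proof
      assume "finite X"
      then have "small (X \<union> ({z} \<union> {y. (y, z) \<in> R}))"
        by (intro small_Un small_below) (auto intro: small_finite)
      moreover have "{x. t x = a} \<subseteq> X \<union> ({z} \<union> {y. (y, z) \<in> R})"
        unfolding X_def using total by blast
      ultimately show False
        using t[of a] small_subset by blast
    qed
    have "\<exists>q. q \<in> snd (f x)" if "x \<in> X" for x
    proof -
      have "t x \<in> below (fst \<circ> f) x"
        using z that unfolding X_def below_def by auto
      then show ?thesis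
        using f[of x] unfolding stage_def Let_def by blast
    qed
    then obtain q where q: "\<And>x. x \<in> X \<Longrightarrow> q x \<in> snd (f x)"
      by metis
    \<comment> \<open>Every stage protects only elements not protected earlier, so distinct stages
      yield distinct elements of \<open>Z\<close>.\<close>
    have disjoint: "snd (f x) \<inter> snd (f y) = {}" if "(x, y) \<in> R" for x y
      using f[of y] that unfolding stage_def Let_def below_def by auto
    have "inj_on q X"
    proof (rule inj_onI, rule ccontr)
      fix x y assume "x \<in> X" "y \<in> X" "q x = q y" "x \<noteq> y"
      then show False
        using q[of x] q[of y] total[of x y] disjoint[of x y] disjoint[of y x] by auto
    qed
    then have "infinite (q ` X)"
      using \<open>infinite X\<close> finite_image_iff by blast
    moreover have prot: "protected A a (q x)" if "x \<in> X" for x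
      using protected[OF q[OF that]] that unfolding X_def by simp
    then have "q ` X \<inter> hfold h (A - {a}) = {}"
      unfolding protected_def by blast
    moreover have "\<forall>j<h. q ` X \<inter> hfold j A = {}"
    proof (intro allI impI)
      fix j assume "j < h"
      have "q x \<notin> hfold j A" if "x \<in> X" for x
      proof
        assume "q x \<in> hfold j A"
        then have "q x - q x \<notin> D"
          using prot[OF that] \<open>j < h\<close> unfolding protected_def by blast
        then show False
          using zero_in_D by simp
      qed
      then show "q ` X \<inter> hfold j A = {}"
        by blast
    qed
    ultimately show ?thesis by blast
  qed
  ultimately show ?thesis
    by (intro exI[of _ A]) auto
qed

end

section \<open>Exact order and minimality from infinite sets of missed elements\<close>

theorem theorem1p1:
  fixes h :: nat
  assumes "infinite (UNIV :: 'a::ab_group_add set)" and "h \<ge> 2"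
  shows "\<exists>A :: 'a set. nice_basis h A \<and> minimal_basis h A"
proof -
  obtain d where "torsion_modulus TYPE('a) d"
    using ex_torsion_modulus[OF assms(1)] by blast
  then interpret basis_construction "TYPE('a)" d h
    using assms(2) by (simp add: basis_construction_def basis_construction_axioms_def)
  obtain A :: "'a set" where A: "hfold h A = UNIV" "\<And>a. a \<in> A \<Longrightarrow>
      \<exists>Z. infinite Z \<and> Z \<inter> hfold h (A - {a}) = {} \<and> (\<forall>j<h. Z \<inter> hfold j A = {})"
    using ex_strongly_minimal_basis by blast
  have not_basis: "\<not> basis_at_most j X" if "infinite Z" "Z \<inter> hfold j X = {}" for Z X :: "'a set" and j
  proof -
    have "Z \<subseteq> sym_diff (hfold j X) UNIV"
      using that(2) by blast
    then show ?thesis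
      unfolding basis_at_most_def almost_eq_def using that(1) finite_subset by blast
  qed
  \<comment> \<open>Some element of \<open>A\<close> is required to obtain an infinite set missed by
    jA for every j < h, which bounds the order from below.\<close>
  have "A \<noteq> {}"
  proof
    assume "A = {}"
    then have "hfold h A = {}"
      using assms(2) unfolding hfold_def by auto
    then show False
      using A(1) by simp
  qed
  have "basis_at_most h A"
    unfolding basis_at_most_def almost_eq_def using A(1) by simp
  moreover have "h \<le> j" if "basis_at_most j A" for j
    using that \<open>A \<noteq> {}\<close> A(2) not_basis by (meson ex_in_conv not_le)
  ultimately have "ord_star A = enat h"
    unfolding ord_star_def using assms(2)
    by (intro antisym INF_greatest INF_lower) auto
  moreover have "\<not> basis_at_most h (A - {a})" if "a \<in> A" for a
    using A(2)[OF that] not_basis by blast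
  ultimately show ?thesis
    using A(1) unfolding nice_basis_def minimal_basis_def by blast
qed

end
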